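(* Let $m\ge3$, let $a_1,\dots,a_m\ge2$ be integers and let $D_m\le S_m$ be the dihedral group of order $2m$ acting on $[m]$ as the symmetry group of a regular $m$-gon whose vertices are labelled $1,\dots,m$ in cyclic order. If $m$ is odd, then \[R_{D_m}(a_1,\dots,a_m)=\min\{a_i:1\le i\le m\}.\] If $m$ is even, then \[R_{D_m}(a_1,\dots,a_m)\le R_{S_2}(n_1,n_2),\] where $n_1=\min\{a_1,a_3,\dots,a_{m-1}\}$ and $n_2=\min\{a_2,a_4,\dots,a_m\}$.
   Context: An $m$-edge-coloured complete graph is a complete graph with each edge coloured from $[m]=\{1,\dots,m\}$. For $\Gamma\le S_m$, $\pi\in\Gamma$ and a vertex $v$, switching at $v$ with $\pi$ recolours every edge incident with $v$ of colour $i$ to colour $\pi(i)$, leaving other edges unchanged. Two such graphs on the same vertex set are $\Gamma$-switch equivalent if one is obtained from the other by a finite sequence of switches. $K_t^{(i)}$ is a complete graph on $t$ vertices with all edges of colour $i$. $R_\Gamma(a_1,\dots,a_m)$ is the least $n$ such that every $m$-edge-coloured complete graph on $n$ vertices is $\Gamma$-switch equivalent to one containing, for some $i$, a copy of $K_{a_i}^{(i)}$. In particular $R_{S_2}(n_1,n_2)$ is this number for $2$-edge-colourings with $S_2$ (switching at $v$ swaps colours $1$ and $2$ on edges at $v$). *)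

theory Defs
  imports Complex_Main "HOL-Library.Ramsey" "HOL-Combinatorics.Permutations"
begin

text \<open>
  An \<open>m\<close>-edge-colouring of the complete graph on \<open>V\<close> is a function \<open>c \<in> [V]\<^bsup>2\<^esup> \<rightarrow> {1..m}\<close>.
  Colourings are total functions on sets of vertices; values outside \<open>[V]\<^bsup>2\<^esup>\<close>
  are never inspected, so it does not matter that \<open>switch_at\<close> may change them.
  A group \<open>\<Gamma> \<le> S\<^sub>m\<close> is represented by the set of its elements, each of which permutes
  \<open>{1..m}\<close> and fixes every other number.
\<close>

definition switch_at :: "'v \<Rightarrow> (nat \<Rightarrow> nat) \<Rightarrow> ('v set \<Rightarrow> nat) \<Rightarrow> ('v set \<Rightarrow> nat)" where
  "switch_at v \<pi> c = (\<lambda>e. if v \<in> e then \<pi> (c e) else c e)"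

definition switch_step ::
  "(nat \<Rightarrow> nat) set \<Rightarrow> 'v set \<Rightarrow> ('v set \<Rightarrow> nat) \<Rightarrow> ('v set \<Rightarrow> nat) \<Rightarrow> bool" where
  "switch_step \<Gamma> V c c' \<longleftrightarrow> (\<exists>v\<in>V. \<exists>\<pi>\<in>\<Gamma>. c' = switch_at v \<pi> c)"

definition switch_equivalent ::
  "(nat \<Rightarrow> nat) set \<Rightarrow> 'v set \<Rightarrow> ('v set \<Rightarrow> nat) \<Rightarrow> ('v set \<Rightarrow> nat) \<Rightarrow> bool" where
  "switch_equivalent \<Gamma> V = (switch_step \<Gamma> V)\<^sup>*\<^sup>*"

definition switch_arrows :: "nat \<Rightarrow> (nat \<Rightarrow> nat) set \<Rightarrow> (nat \<Rightarrow> nat) \<Rightarrow> nat \<Rightarrow> bool" where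
  "switch_arrows m \<Gamma> a n \<longleftrightarrow>
    (\<forall>c \<in> [{..<n}]\<^bsup>2\<^esup> \<rightarrow> {1..m}.
       \<exists>c'. switch_equivalent \<Gamma> {..<n} c c' \<and>
            (\<exists>i\<in>{1..m}. monochromatic {..<n} (a i) 2 c' i))"

definition switch_ramsey :: "nat \<Rightarrow> (nat \<Rightarrow> nat) set \<Rightarrow> (nat \<Rightarrow> nat) \<Rightarrow> nat" where
  "switch_ramsey m \<Gamma> a = (LEAST n. switch_arrows m \<Gamma> a n)"

text \<open>By Ramsey's theorem the minimum in \<open>switch_ramsey\<close> is over a nonempty set.\<close>

lemma switch_arrows_exists:
  assumes "m \<ge> 1"
  shows "\<exists>n. switch_arrows m \<Gamma> a n"
proof -
  let ?as = "map (\<lambda>i. a (Suc i)) [0..<m]"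
  obtain N :: nat where N: "partn_lst {..<N} ?as 2"
    using ramsey_full by blast
  have "switch_arrows m \<Gamma> a N"
    unfolding switch_arrows_def
  proof
    fix c :: "nat set \<Rightarrow> nat"
    assume c: "c \<in> [{..<N}]\<^bsup>2\<^esup> \<rightarrow> {1..m}"
    have "(\<lambda>e. c e - 1) \<in> [{..<N}]\<^bsup>2\<^esup> \<rightarrow> {..<length ?as}"
      using c by (fastforce simp: Pi_iff)
    with N obtain i where i: "i < m" and "monochromatic {..<N} (a (Suc i)) 2 (\<lambda>e. c e - 1) i"
      unfolding partn_lst_def by fastforce
    then obtain H where H: "H \<in> [{..<N}]\<^bsup>(a (Suc i))\<^esup>" "(\<lambda>e. c e - 1) ` [H]\<^bsup>2\<^esup> \<subseteq> {i}"
      unfolding monochromatic_def by blast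
    have "c e = Suc i" if e: "e \<in> [H]\<^bsup>2\<^esup>" for e
    proof -
      have "e \<in> [{..<N}]\<^bsup>2\<^esup>"
        using e H(1) by (auto simp: nsets_def)
      then have "c e \<ge> 1"
        using c by (auto simp: Pi_iff)
      moreover have "c e - 1 = i"
        using e H(2) by auto
      ultimately show ?thesis
        by linarith
    qed
    then have "monochromatic {..<N} (a (Suc i)) 2 c (Suc i)"
      using H(1) unfolding monochromatic_def by blast
    moreover have "switch_equivalent \<Gamma> {..<N} c c"
      by (simp add: switch_equivalent_def)
    ultimately show "\<exists>c'. switch_equivalent \<Gamma> {..<N} c c' \<and>
        (\<exists>i\<in>{1..m}. monochromatic {..<N} (a i) 2 c' i)"
      using i by (intro exI[of _ c] conjI bexI[of _ "Suc i"]) auto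
  qed
  then show ?thesis by blast
qed

definition symmetric_group :: "nat \<Rightarrow> (nat \<Rightarrow> nat) set" where
  "symmetric_group m = {\<pi>. \<pi> permutes {1..m}}"

text \<open>
  The vertices \<open>1, \<dots>, m\<close> of the regular \<open>m\<close>-gon inscribed in the unit circle, in cyclic order;
  the dihedral group consists of the permutations of the labels induced by isometries of the plane.
\<close>

definition polygon_vertex :: "nat \<Rightarrow> nat \<Rightarrow> complex" where
  "polygon_vertex m k = cis (2 * pi * real k / real m)"

definition dihedral_group :: "nat \<Rightarrow> (nat \<Rightarrow> nat) set" where
  "dihedral_group m = {\<pi>. \<pi> permutes {1..m} \<and>
     (\<exists>f :: complex \<Rightarrow> complex. (\<forall>x y. dist (f x) (f y) = dist x y) \<and>
        (\<forall>k\<in>{1..m}. f (polygon_vertex m k) = polygon_vertex m (\<pi> k)))}"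

end

theory Submission
  imports Defs
begin

text \<open>
  Two involutions \<open>\<sigma>, \<tau>\<close> in the switching group give, by switching at \<open>u, v, u, v\<close> with
  \<open>\<tau>, \<sigma>, \<tau>, \<sigma>\<close>, a recolouring of the single edge \<open>uv\<close> by \<open>\<sigma>\<tau>\<sigma>\<tau>\<close>. For the reflections
  \<open>x \<mapsto> -x\<close> and \<open>x \<mapsto> 1 - x\<close> of the polygon this recolours one edge by \<open>x \<mapsto> x - 2\<close>. If \<open>m\<close> is
  odd, every edge can thus be given any colour, so all colourings are equivalent. If \<open>m\<close> is even,
  every edge can be given any colour of the same parity, and \<open>x \<mapsto> 1 - x\<close> exchanges the parities,
  so that switching the parity colouring with \<open>S\<^sub>2\<close> lifts to switching with \<open>D\<^sub>m\<close>.
\<close>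

section \<open>Switch equivalence and the recolouring of chosen edges\<close>

lemma switch_equivalent_refl: "switch_equivalent \<Gamma> V c c"
  by (simp add: switch_equivalent_def)

lemma switch_equivalent_trans:
  "switch_equivalent \<Gamma> V c d \<Longrightarrow> switch_equivalent \<Gamma> V d e \<Longrightarrow> switch_equivalent \<Gamma> V c e"
  by (simp add: switch_equivalent_def)

lemma switch_equivalent_switch_at:
  "v \<in> V \<Longrightarrow> \<pi> \<in> \<Gamma> \<Longrightarrow> switch_equivalent \<Gamma> V c (switch_at v \<pi> c)"
  unfolding switch_equivalent_def by (rule r_into_rtranclp) (auto simp: switch_step_def)

text \<open>An edge sharing exactly one vertex with \<open>e\<close> sees the same involution twice
  and gets its colour back; an edge disjoint from \<open>e\<close> sees nothing. Only
  \<open>e\<close> meets both switched vertices, where the involutions interleave and need not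
  cancel.\<close>

lemma recolour_edge:
  assumes "\<sigma> \<in> \<Gamma>" "\<tau> \<in> \<Gamma>" "\<sigma> \<circ> \<sigma> = id" "\<tau> \<circ> \<tau> = id" "e \<in> [V]\<^bsup>2\<^esup>"
  shows "\<exists>c'. switch_equivalent \<Gamma> V c c' \<and> c' e = (\<sigma> \<circ> \<tau> \<circ> \<sigma> \<circ> \<tau>) (c e) \<and>
    (\<forall>e'\<in>[V]\<^bsup>2\<^esup> - {e}. c' e' = c e')"
proof -
  obtain u v where uv: "e = {u, v}" "u \<noteq> v" "u \<in> V" "v \<in> V"
    using assms(5) unfolding nsets_def by (auto simp: card_2_iff)
  have inv: "\<sigma> (\<sigma> x) = x" "\<tau> (\<tau> x) = x" for x
    using assms(3,4) by (simp_all add: fun_eq_iff)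
  let ?c = "switch_at v \<sigma> (switch_at u \<tau> (switch_at v \<sigma> (switch_at u \<tau> c)))"
  have "switch_equivalent \<Gamma> V c ?c"
    using assms(1,2) uv(3,4)
    by (meson switch_equivalent_switch_at switch_equivalent_trans)
  moreover have "?c e = (\<sigma> \<circ> \<tau> \<circ> \<sigma> \<circ> \<tau>) (c e)"
    using uv(1) by (simp add: switch_at_def)
  moreover have "?c e' = c e'" if "e' \<in> [V]\<^bsup>2\<^esup> - {e}" for e'
  proof -
    have "\<not> (u \<in> e' \<and> v \<in> e')"
      using that uv(1,2) unfolding nsets_def by (auto simp: card_2_iff)
    then show ?thesis
      by (auto simp: switch_at_def inv)
  qed
  ultimately show ?thesis
    by blast
qed

lemma recolour_edge_funpow:
  assumes "\<sigma> \<in> \<Gamma>" "\<tau> \<in> \<Gamma>" "\<sigma> \<circ> \<sigma> = id" "\<tau> \<circ> \<tau> = id" "e \<in> [V]\<^bsup>2\<^esup>"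
  shows "\<exists>c'. switch_equivalent \<Gamma> V c c' \<and> c' e = ((\<sigma> \<circ> \<tau> \<circ> \<sigma> \<circ> \<tau>) ^^ k) (c e) \<and>
    (\<forall>e'\<in>[V]\<^bsup>2\<^esup> - {e}. c' e' = c e')"
proof (induction k)
  case 0
  show ?case
    using switch_equivalent_refl by (metis funpow_0)
next
  case (Suc k)
  then obtain c1 where c1: "switch_equivalent \<Gamma> V c c1"
      "c1 e = ((\<sigma> \<circ> \<tau> \<circ> \<sigma> \<circ> \<tau>) ^^ k) (c e)" "\<forall>e'\<in>[V]\<^bsup>2\<^esup> - {e}. c1 e' = c e'"
    by blast
  obtain c2 where c2: "switch_equivalent \<Gamma> V c1 c2"
      "c2 e = (\<sigma> \<circ> \<tau> \<circ> \<sigma> \<circ> \<tau>) (c1 e)" "\<forall>e'\<in>[V]\<^bsup>2\<^esup> - {e}. c2 e' = c1 e'"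
    using recolour_edge[OF assms, of c1] by blast
  have "c2 e = ((\<sigma> \<circ> \<tau> \<circ> \<sigma> \<circ> \<tau>) ^^ Suc k) (c e)"
    by (simp add: c1(2) c2(2))
  moreover have "\<forall>e'\<in>[V]\<^bsup>2\<^esup> - {e}. c2 e' = c e'"
    using c1(3) c2(3) by simp
  ultimately show ?case
    using switch_equivalent_trans[OF c1(1) c2(1)] by blast
qed

text \<open>The edges are treated one after another. The last conjunct carries the induction: an
  edge not yet treated still has its original colour, so a hypothesis about \<open>c\<close> alone
  suffices.\<close>

lemma recolour_edges:
  assumes "\<sigma> \<in> \<Gamma>" "\<tau> \<in> \<Gamma>" "\<sigma> \<circ> \<sigma> = id" "\<tau> \<circ> \<tau> = id"
    and "finite E" "E \<subseteq> [V]\<^bsup>2\<^esup>"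
    and "\<forall>e\<in>E. \<exists>k. ((\<sigma> \<circ> \<tau> \<circ> \<sigma> \<circ> \<tau>) ^^ k) (c e) = t e"
  shows "\<exists>c'. switch_equivalent \<Gamma> V c c' \<and> (\<forall>e\<in>E. c' e = t e) \<and>
    (\<forall>e\<in>[V]\<^bsup>2\<^esup> - E. c' e = c e)"
  using assms(5-7)
proof (induction E rule: finite_induct)
  case empty
  show ?case
    using switch_equivalent_refl by blast
next
  case (insert e E)
  then obtain c1 where c1: "switch_equivalent \<Gamma> V c c1" "\<forall>e\<in>E. c1 e = t e"
      "\<forall>e\<in>[V]\<^bsup>2\<^esup> - E. c1 e = c e"
    by auto
  have e: "e \<in> [V]\<^bsup>2\<^esup>" and ce: "c1 e = c e"
    using insert.prems(1) insert.hyps(2) c1(3) by auto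
  obtain k where k: "((\<sigma> \<circ> \<tau> \<circ> \<sigma> \<circ> \<tau>) ^^ k) (c e) = t e"
    using insert.prems(2) by blast
  obtain c2 where c2: "switch_equivalent \<Gamma> V c1 c2"
      "c2 e = ((\<sigma> \<circ> \<tau> \<circ> \<sigma> \<circ> \<tau>) ^^ k) (c1 e)" "\<forall>e'\<in>[V]\<^bsup>2\<^esup> - {e}. c2 e' = c1 e'"
    using recolour_edge_funpow[OF assms(1-4) e, of c1 k] by blast
  have "c2 e' = t e'" if "e' \<in> insert e E" for e'
  proof (cases "e' = e")
    case True
    then show ?thesis by (simp add: c2(2) ce k)
  next
    case False
    then have "e' \<in> E" "e' \<in> [V]\<^bsup>2\<^esup> - {e}"
      using that insert.prems(1) by auto
    then show ?thesis
      using c1(2) c2(3) by metis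
  qed
  moreover have "\<forall>e'\<in>[V]\<^bsup>2\<^esup> - insert e E. c2 e' = c e'"
    using c1(3) c2(3) by simp
  ultimately show ?case
    using switch_equivalent_trans[OF c1(1) c2(1)] by blast
qed

section \<open>Two reflections of the polygon\<close>

definition vertex_reflection :: "nat \<Rightarrow> nat \<Rightarrow> nat" where
  "vertex_reflection m k = (if k \<in> {1..<m} then m - k else k)"

text \<open>Labels are residues modulo \<open>m\<close>, with \<open>m\<close> representing 0. The
  previous map is negation, whose axis passes through vertex \<open>m\<close>; this one is
  \<open>x \<mapsto> 1 - x\<close>, whose axis bisects the side joining \<open>m\<close> and
  1.\<close>

definition edge_reflection :: "nat \<Rightarrow> nat \<Rightarrow> nat" where
  "edge_reflection m k = (if k \<in> {1..m} then m + 1 - k else k)"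

lemma vertex_reflection_involution: "vertex_reflection m \<circ> vertex_reflection m = id"
  by (auto simp: vertex_reflection_def fun_eq_iff)

lemma edge_reflection_involution: "edge_reflection m \<circ> edge_reflection m = id"
  by (auto simp: edge_reflection_def fun_eq_iff)

lemma vertex_reflection_permutes: "vertex_reflection m permutes {1..m}"
  unfolding permutes_def
proof (intro conjI allI impI)
  show "vertex_reflection m x = x" if "x \<notin> {1..m}" for x
    using that by (auto simp: vertex_reflection_def)
  show "\<exists>!x. vertex_reflection m x = y" for y
    using vertex_reflection_involution[of m] by (metis comp_apply id_apply)
qed

lemma edge_reflection_permutes: "edge_reflection m permutes {1..m}"
  unfolding permutes_def
proof (intro conjI allI impI)
  show "edge_reflection m x = x" if "x \<notin> {1..m}" for x
    using that by (auto simp: edge_reflection_def)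
  show "\<exists>!x. edge_reflection m x = y" for y
    using edge_reflection_involution[of m] by (metis comp_apply id_apply)
qed

lemma dist_cnj: "dist (cnj x) (cnj y) = dist x y"
  by (metis complex_cnj_diff complex_mod_cnj dist_norm)

text \<open>The inducing isometry is complex conjugation, since vertex \<open>m\<close> lies at 1 on
  the real axis.\<close>

lemma vertex_reflection_dihedral:
  assumes "m \<ge> 1"
  shows "vertex_reflection m \<in> dihedral_group m"
proof -
  have "cnj (polygon_vertex m k) = polygon_vertex m (vertex_reflection m k)"
    if "k \<in> {1..m}" for k
  proof (cases "k = m")
    case True
    then show ?thesis
      using assms by (simp add: polygon_vertex_def vertex_reflection_def)
  next
    case False
    \<comment> \<open>The extra full turn brings the negated angle back to a label in range; it
      disappears because \<open>cis (2 * pi) = 1\<close>.\<close>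
    then have "2 * pi * real (m - k) / real m = 2 * pi + - (2 * pi * real k / real m)"
      using that by (simp add: of_nat_diff field_simps)
    then have "polygon_vertex m (m - k) = cis (2 * pi) * cis (- (2 * pi * real k / real m))"
      unfolding polygon_vertex_def by (simp only: cis_mult)
    then show ?thesis
      using False that by (simp add: polygon_vertex_def vertex_reflection_def cis_cnj)
  qed
  then show ?thesis
    unfolding dihedral_group_def
    using vertex_reflection_permutes dist_cnj by blast
qed

text \<open>The inducing isometry is conjugation followed by the rotation through one step of the
  polygon; the factor has norm 1, so distances are kept.\<close>

lemma edge_reflection_dihedral:
  assumes "m \<ge> 1"
  shows "edge_reflection m \<in> dihedral_group m"
proof -
  let ?f = "\<lambda>z. cis (2 * pi / real m) * cnj z"
  have "?f (polygon_vertex m k) = polygon_vertex m (edge_reflection m k)"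
    if "k \<in> {1..m}" for k
  proof -
    have "2 * pi * real (m + 1 - k) / real m
        = 2 * pi + (2 * pi / real m + - (2 * pi * real k / real m))"
      using that by (simp add: of_nat_diff field_simps)
    then have "polygon_vertex m (m + 1 - k)
        = cis (2 * pi) * (cis (2 * pi / real m) * cis (- (2 * pi * real k / real m)))"
      unfolding polygon_vertex_def by (simp only: cis_mult)
    then show ?thesis
      using that by (simp add: polygon_vertex_def edge_reflection_def cis_cnj)
  qed
  moreover have "dist (?f x) (?f y) = dist x y" for x y
    by (metis dist_cnj dist_norm mult.left_neutral norm_cis norm_mult right_diff_distrib)
  ultimately show ?thesis
    unfolding dihedral_group_def
    using edge_reflection_permutes by (intro CollectI conjI exI[of _ ?f]) blast+
qed

section \<open>Orbits of the shift by two\<close>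

definition two_step :: "nat \<Rightarrow> nat \<Rightarrow> nat" where
  "two_step m = vertex_reflection m \<circ> edge_reflection m \<circ> vertex_reflection m \<circ> edge_reflection m"

text \<open>Edge reflection followed by vertex reflection is the rotation
  \<open>x \<mapsto> x - 1\<close> modulo \<open>m\<close>, and \<open>two_step\<close> is its
  square. The labels 1 and 2 wrap around to \<open>m - 1\<close> and \<open>m\<close>.\<close>

lemma two_step_eq:
  assumes "m \<ge> 2" "x \<in> {1..m}"
  shows "two_step m x = (if x > 2 then x - 2 else x + m - 2)"
  using assms by (auto simp: two_step_def vertex_reflection_def edge_reflection_def)

text \<open>Being in range and congruent to \<open>x - 2 * k\<close> modulo \<open>m\<close>
  determines the iterate. The congruence is taken over the integers because subtraction of naturals
  truncates.\<close>

lemma funpow_two_step: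
  assumes "m \<ge> 2" "x \<in> {1..m}"
  shows "(two_step m ^^ k) x \<in> {1..m} \<and> int m dvd int x - 2 * int k - int ((two_step m ^^ k) x)"
proof (induction k)
  case 0
  then show ?case using assms by simp
next
  case (Suc k)
  define y where "y = (two_step m ^^ k) x"
  have y: "y \<in> {1..m}" "int m dvd int x - 2 * int k - int y"
    using Suc by (auto simp: y_def)
  show ?case
  proof (cases "y > 2")
    case True
    then have s: "(two_step m ^^ Suc k) x = y - 2"
      using two_step_eq[OF assms(1) y(1)] by (simp add: y_def)
    have "int x - 2 * int (Suc k) - int (y - 2) = int x - 2 * int k - int y"
      using True by (simp add: of_nat_diff)
    with s True y show ?thesis by (simp only:) auto
  next
    case False
    then have s: "(two_step m ^^ Suc k) x = y + m - 2"
      using two_step_eq[OF assms(1) y(1)] by (simp add: y_def)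
    have "int x - 2 * int (Suc k) - int (y + m - 2) = int x - 2 * int k - int y - int m"
      using assms(1) by (simp add: of_nat_diff)
    with y(2) have "int m dvd int x - 2 * int (Suc k) - int (y + m - 2)"
      by (metis dvd_diff dvd_refl)
    with s False y(1) assms(1) show ?thesis by auto
  qed
qed

lemma two_step_orbit:
  assumes "m \<ge> 2" "x \<in> {1..m}" "y \<in> {1..m}" "odd m \<or> even x = even y"
  shows "\<exists>k. (two_step m ^^ k) x = y"
proof -
  \<comment> \<open>A shift count is half of an even nonnegative number congruent to
    \<open>x - y\<close>. One added \<open>m\<close> makes the difference nonnegative; if it is then
    odd, the parity hypothesis forces \<open>m\<close> to be odd, and a second \<open>m\<close>
    repairs the parity.\<close>
  obtain q k where k: "int x + int q * int m - int y = 2 * int k"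
  proof (cases "even (x + m - y)")
    case True
    then obtain k where "x + m - y = 2 * k" by blast
    then show ?thesis using that[of 1 k] assms(3) by auto
  next
    case False
    then have "even (x + 2 * m - y)"
      using assms(3,4) by auto
    then obtain k where "x + 2 * m - y = 2 * k" by blast
    then show ?thesis using that[of 2 k] assms(3) by auto
  qed
  define z where "z = (two_step m ^^ k) x"
  have z: "z \<in> {1..m}" "int m dvd int x - 2 * int k - int z"
    using funpow_two_step[OF assms(1,2), of k] by (auto simp: z_def)
  have "int x - 2 * int k - int z = int y - int z - int q * int m"
    using k by simp
  then have "int m dvd int y - int z"
    using z(2) by (metis diff_add_cancel dvd_add dvd_triv_right)
  moreover have "\<bar>int y - int z\<bar> < int m"
    using z(1) assms(3) by auto
  ultimately have "z = y"
    using dvd_imp_le_int[of "int y - int z" "int m"] by fastforce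
  then show ?thesis
    using z_def by blast
qed

text \<open>Meant for \<open>E\<close> the edge set of a clique, which thereby becomes monochromatic
  in colour \<open>j\<close>: the last hypothesis puts every colour on \<open>E\<close> in the orbit
  of \<open>j\<close> under \<open>two_step\<close>.\<close>

lemma dihedral_recolour:
  assumes "m \<ge> 2" "finite E" "E \<subseteq> [V]\<^bsup>2\<^esup>" "j \<in> {1..m}"
    and "\<forall>e\<in>E. c e \<in> {1..m} \<and> (odd m \<or> even (c e) = even j)"
  shows "\<exists>c'. switch_equivalent (dihedral_group m) V c c' \<and> (\<forall>e\<in>E. c' e = j)"
proof -
  have "\<forall>e\<in>E. \<exists>k. (two_step m ^^ k) (c e) = j"
    using two_step_orbit assms by blast
  then show ?thesis
    using recolour_edges[of "vertex_reflection m" "dihedral_group m" "edge_reflection m" E V c "\<lambda>_. j"]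
      vertex_reflection_dihedral[of m] edge_reflection_dihedral[of m]
      vertex_reflection_involution edge_reflection_involution assms(1-3)
    by (auto simp: two_step_def)
qed

section \<open>The lower bound by clique size, and odd \<open>m\<close>\<close>

lemma finite_nsets_lessThan: "finite ([{..<n::nat}]\<^bsup>k\<^esup>)"
  by (simp add: finite_imp_finite_nsets)

text \<open>Switching adds no vertices, so a clique of size \<open>a i\<close> needs
  \<open>n\<close> to be at least \<open>a i\<close>. The constant colouring is just some admissible
  colouring to which the arrow property can be applied.\<close>

lemma switch_arrows_ge_Min:
  assumes "m \<ge> 1" "switch_arrows m \<Gamma> a n"
  shows "Min (a ` {1..m}) \<le> n"
proof -
  have "(\<lambda>_. 1) \<in> [{..<n}]\<^bsup>2\<^esup> \<rightarrow> {1..m}"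
    using assms(1) by auto
  then obtain c' i where i: "i \<in> {1..m}" "monochromatic {..<n} (a i) 2 c' i"
    using assms(2) unfolding switch_arrows_def by blast
  then obtain H where "H \<subseteq> {..<n}" "card H = a i"
    unfolding monochromatic_def nsets_def by auto
  then have "a i \<le> n"
    using card_mono[of "{..<n}" H] by simp
  moreover have "Min (a ` {1..m}) \<le> a i"
    using i(1) by simp
  ultimately show ?thesis by linarith
qed

lemma switch_ramsey_dihedral_odd:
  assumes "odd m" "m \<ge> 2"
  shows "switch_ramsey m (dihedral_group m) a = Min (a ` {1..m})"
  unfolding switch_ramsey_def
proof (rule Least_equality)
  have "Min (a ` {1..m}) \<in> a ` {1..m}"
    using assms(2) by (intro Min_in) auto
  then obtain i where i: "i \<in> {1..m}" "Min (a ` {1..m}) = a i"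
    by blast
  \<comment> \<open>On \<open>a i\<close> vertices, with \<open>i\<close> attaining the minimum, the
    whole complete graph can be given colour \<open>i\<close>.\<close>
  have "switch_arrows m (dihedral_group m) a (a i)"
    unfolding switch_arrows_def
  proof
    fix c assume "c \<in> [{..<a i}]\<^bsup>2\<^esup> \<rightarrow> {1..m}"
    then have "\<forall>e\<in>[{..<a i}]\<^bsup>2\<^esup>. c e \<in> {1..m} \<and> (odd m \<or> even (c e) = even i)"
      using assms(1) by blast
    then obtain c' where c': "switch_equivalent (dihedral_group m) {..<a i} c c'"
        "\<forall>e\<in>[{..<a i}]\<^bsup>2\<^esup>. c' e = i"
      using dihedral_recolour[OF assms(2) finite_nsets_lessThan order_refl i(1)] by blast
    have "{..<a i} \<in> [{..<a i}]\<^bsup>(a i)\<^esup>"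
      by (simp add: nsets_def)
    moreover have "c' ` [{..<a i}]\<^bsup>2\<^esup> \<subseteq> {i}"
      using c'(2) by blast
    ultimately have "monochromatic {..<a i} (a i) 2 c' i"
      unfolding monochromatic_def by blast
    with c'(1) i(1) show "\<exists>c'. switch_equivalent (dihedral_group m) {..<a i} c c' \<and>
        (\<exists>i'\<in>{1..m}. monochromatic {..<a i} (a i') 2 c' i')"
      by blast
  qed
  then show "switch_arrows m (dihedral_group m) a (Min (a ` {1..m}))"
    by (simp only: i(2))
  show "Min (a ` {1..m}) \<le> n" if "switch_arrows m (dihedral_group m) a n" for n
    using switch_arrows_ge_Min[OF _ that] assms(2) by simp
qed

section \<open>Even \<open>m\<close>: reduction to two colours by parity\<close>

definition parity_colour :: "nat \<Rightarrow> nat" where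
  "parity_colour x = (if odd x then 1 else 2)"

lemma parity_colour_eq_iff: "parity_colour x = parity_colour y \<longleftrightarrow> even x = even y"
  by (simp add: parity_colour_def)

text \<open>Each switch of the parity colouring is simulated in turn: the identity by doing nothing,
  the transposition by \<open>edge_reflection\<close>, which sends \<open>k\<close> to
  \<open>m + 1 - k\<close> and so flips parity because \<open>m + 1\<close> is odd.\<close>

lemma lift_switch_equivalent:
  assumes "even m" "m \<ge> 1"
    and "switch_equivalent (symmetric_group 2) V d0 d"
    and "\<forall>e\<in>[V]\<^bsup>2\<^esup>. c e \<in> {1..m} \<and> parity_colour (c e) = d0 e"
  shows "\<exists>c'. switch_equivalent (dihedral_group m) V c c' \<and>
    (\<forall>e\<in>[V]\<^bsup>2\<^esup>. c' e \<in> {1..m} \<and> parity_colour (c' e) = d e)"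
  using assms(3) unfolding switch_equivalent_def[of "symmetric_group 2"]
proof (induction rule: rtranclp_induct)
  case base
  show ?case
    using assms(4) switch_equivalent_refl by blast
next
  case (step d d')
  then obtain c1 where c1: "switch_equivalent (dihedral_group m) V c c1"
      "\<forall>e\<in>[V]\<^bsup>2\<^esup>. c1 e \<in> {1..m} \<and> parity_colour (c1 e) = d e"
    by blast
  obtain v \<pi> where v: "v \<in> V" "\<pi> permutes {1..2}" "d' = switch_at v \<pi> d"
    using step.hyps(2) by (auto simp: switch_step_def symmetric_group_def)
  have "\<pi> 1 \<in> {1..2}" "\<pi> 2 \<in> {1..2}"
    using permutes_in_image[OF v(2), of 1] permutes_in_image[OF v(2), of 2] by simp_all
  moreover have "\<pi> 1 \<noteq> \<pi> 2"
    using injD[OF permutes_inj[OF v(2)], of 1 2] by auto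
  ultimately have "\<pi> 1 = 1 \<and> \<pi> 2 = 2 \<or> \<pi> 1 = 2 \<and> \<pi> 2 = 1"
    unfolding atLeastAtMost_iff by arith
  then consider "\<pi> 1 = 1" "\<pi> 2 = 2" | "\<pi> 1 = 2" "\<pi> 2 = 1"
    by blast
  then show ?case
  proof cases
    case 1
    \<comment> \<open>Parity colours are only 1 or 2, so this \<open>\<pi>\<close> changes no edge
      colour of \<open>d\<close> and \<open>c1\<close> still lifts \<open>d'\<close>.\<close>
    then have "\<pi> (parity_colour x) = parity_colour x" for x
      by (simp add: parity_colour_def)
    then have "\<forall>e\<in>[V]\<^bsup>2\<^esup>. c1 e \<in> {1..m} \<and> parity_colour (c1 e) = d' e"
      using c1(2) by (simp add: v(3) switch_at_def) metis
    with c1(1) show ?thesis by blast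
  next
    case 2
    let ?c = "switch_at v (edge_reflection m) c1"
    have flip: "edge_reflection m x \<in> {1..m}"
      "parity_colour (edge_reflection m x) = \<pi> (parity_colour x)" if "x \<in> {1..m}" for x
      using that 2 assms(1) by (auto simp: edge_reflection_def parity_colour_def)
    have "switch_equivalent (dihedral_group m) V c ?c"
      using c1(1) switch_equivalent_switch_at[OF v(1) edge_reflection_dihedral[OF assms(2)]]
      by (rule switch_equivalent_trans)
    moreover have "?c e \<in> {1..m} \<and> parity_colour (?c e) = d' e" if "e \<in> [V]\<^bsup>2\<^esup>" for e
      using c1(2)[rule_format, OF that] flip[of "c1 e"] by (simp add: v(3) switch_at_def)
    ultimately show ?thesis by blast
  qed
qed

text \<open>A clique found in the switched parity colouring lifts to one whose colours all have the
  same parity, and those can be made equal to any chosen \<open>j\<close> of that parity. Choosing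
  \<open>j\<close> with \<open>a j = b i\<close> gives the clique the required size.\<close>

lemma switch_ramsey_dihedral_even:
  assumes "even m" "m \<ge> 2"
    and "\<And>i. i \<in> {1..2} \<Longrightarrow> \<exists>j\<in>{1..m}. parity_colour j = i \<and> a j = b i"
  shows "switch_ramsey m (dihedral_group m) a \<le> switch_ramsey 2 (symmetric_group 2) b"
proof -
  define n where "n = switch_ramsey 2 (symmetric_group 2) b"
  \<comment> \<open>The least number has the arrow property only because some number has it, which
    is Ramsey's theorem.\<close>
  have n: "switch_arrows 2 (symmetric_group 2) b n"
    using switch_arrows_exists[of 2 "symmetric_group 2" b]
    unfolding n_def switch_ramsey_def by (auto intro: LeastI_ex)
  have "switch_arrows m (dihedral_group m) a n"
    unfolding switch_arrows_def
  proof
    fix c assume c: "c \<in> [{..<n}]\<^bsup>2\<^esup> \<rightarrow> {1..m}"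
    have "(\<lambda>e. parity_colour (c e)) \<in> [{..<n}]\<^bsup>2\<^esup> \<rightarrow> {1..2}"
      by (auto simp: parity_colour_def)
    then obtain d i where d: "switch_equivalent (symmetric_group 2) {..<n} (\<lambda>e. parity_colour (c e)) d"
        and i: "i \<in> {1..2}" "monochromatic {..<n} (b i) 2 d i"
      using n unfolding switch_arrows_def by blast
    obtain c1 where c1: "switch_equivalent (dihedral_group m) {..<n} c c1"
        "\<forall>e\<in>[{..<n}]\<^bsup>2\<^esup>. c1 e \<in> {1..m} \<and> parity_colour (c1 e) = d e"
      using lift_switch_equivalent[OF assms(1) _ d, of c] assms(2) c by (auto simp: Pi_iff)
    obtain j where j: "j \<in> {1..m}" "parity_colour j = i" "a j = b i"
      using assms(3)[OF i(1)] by blast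
    obtain H where H: "H \<in> [{..<n}]\<^bsup>(a j)\<^esup>" "d ` [H]\<^bsup>2\<^esup> \<subseteq> {i}"
      using i(2) j(3) unfolding monochromatic_def by auto
    have sub: "[H]\<^bsup>2\<^esup> \<subseteq> [{..<n}]\<^bsup>2\<^esup>"
      using H(1) by (auto simp: nsets_def)
    have "c1 e \<in> {1..m} \<and> (odd m \<or> even (c1 e) = even j)" if "e \<in> [H]\<^bsup>2\<^esup>" for e
    proof -
      have "c1 e \<in> {1..m}" "parity_colour (c1 e) = parity_colour j"
        using c1(2) sub that H(2) j(2) by auto
      then show ?thesis
        by (simp add: parity_colour_eq_iff)
    qed
    \<comment> \<open>Only the edges inside \<open>H\<close> need their final colour; the others may
      end up with any colour.\<close>
    then obtain c2 where c2: "switch_equivalent (dihedral_group m) {..<n} c1 c2"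
        "\<forall>e\<in>[H]\<^bsup>2\<^esup>. c2 e = j"
      using dihedral_recolour[OF assms(2) finite_subset[OF sub finite_nsets_lessThan] sub j(1)]
      by blast
    have "monochromatic {..<n} (a j) 2 c2 j"
      using H(1) c2(2) unfolding monochromatic_def by blast
    then show "\<exists>c'. switch_equivalent (dihedral_group m) {..<n} c c' \<and>
        (\<exists>i\<in>{1..m}. monochromatic {..<n} (a i) 2 c' i)"
      using switch_equivalent_trans[OF c1(1) c2(1)] j(1) by blast
  qed
  then show ?thesis
    unfolding n_def switch_ramsey_def[of m] by (rule Least_le)
qed

theorem theorem11:
  fixes m :: nat and a :: "nat \<Rightarrow> nat"
  assumes "m \<ge> 3"
    and "\<forall>i\<in>{1..m}. a i \<ge> 2"
  shows "(odd m \<longrightarrow> switch_ramsey m (dihedral_group m) a = Min (a ` {1..m})) \<and>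
    (even m \<longrightarrow>
      (let n1 = Min (a ` {i \<in> {1..m}. odd i});
           n2 = Min (a ` {i \<in> {1..m}. even i})
       in switch_ramsey m (dihedral_group m) a
            \<le> switch_ramsey 2 (symmetric_group 2) (\<lambda>i. if i = 1 then n1 else n2)))"
proof (intro conjI impI)
  show "switch_ramsey m (dihedral_group m) a = Min (a ` {1..m})" if "odd m"
    using switch_ramsey_dihedral_odd[OF that] assms(1) by simp
next
  assume "even m"
  define A where "A = {i \<in> {1..m}. odd i}"
  define B where "B = {i \<in> {1..m}. even i}"
  define b where "b = (\<lambda>i::nat. if i = 1 then Min (a ` A) else Min (a ` B))"
  \<comment> \<open>The members 1 and 2 make both parity classes nonempty, so each minimum is
    attained by an index of its own class.\<close>
  have "finite A" "1 \<in> A" "finite B" "2 \<in> B"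
    using assms(1) by (simp_all add: A_def B_def)
  then have "Min (a ` A) \<in> a ` A" "Min (a ` B) \<in> a ` B"
    by (metis Min_in empty_iff finite_imageI image_is_empty)+
  then obtain j k where j: "j \<in> A" "Min (a ` A) = a j"
    and k: "k \<in> B" "Min (a ` B) = a k"
    by blast
  have "\<exists>j\<in>{1..m}. parity_colour j = i \<and> a j = b i" if "i \<in> {1..2}" for i
  proof (cases "i = 1")
    case True
    then show ?thesis
      using j by (intro bexI[of _ j]) (auto simp: b_def A_def B_def parity_colour_def)
  next
    case False
    then have "i = 2"
      using that by auto
    then show ?thesis
      using k by (intro bexI[of _ k]) (auto simp: b_def A_def B_def parity_colour_def)
  qed
  then have "switch_ramsey m (dihedral_group m) a \<le> switch_ramsey 2 (symmetric_group 2) b"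
    using switch_ramsey_dihedral_even[OF \<open>even m\<close>] assms(1) by simp
  then show "let n1 = Min (a ` {i \<in> {1..m}. odd i});
           n2 = Min (a ` {i \<in> {1..m}. even i})
       in switch_ramsey m (dihedral_group m) a
            \<le> switch_ramsey 2 (symmetric_group 2) (\<lambda>i. if i = 1 then n1 else n2)"
    unfolding Let_def b_def A_def B_def .
qed

end
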